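(* Let $A\in\mathbb{R}\cup\{-\infty\}$ and $\gamma>0$. Let $H_1,\dots,H_N:\mathbb{R}\to\mathbb{R}$ be continuous, quasi-convex and coercive, and assume that for each $i$ the function $H_i$ is nonincreasing on $(-\infty,0]$ and nondecreasing on $[0,+\infty)$ (that is, $p_i^0=0$), and that $0=H_1(0)\ge H_2(0)\ge\dots\ge H_N(0)$. Then there exists a function $G:J^2\to\mathbb{R}$ with the following properties. (i) (Regularity) $G\in C(J^2)$, $G(x,\cdot)\in C^1(J)$ for all $x\in J$, and $G(\cdot,y)\in C^1(J)$ for all $y\in J$. (ii) (Bound from below) $G\ge 0=G(0,0)$. (iii) (Compatibility condition on the diagonal) For all $x\in J$, $0\le G(x,x)-G(0,0)\le\gamma$. (iv) (Compatibility condition on the gradients) For all $(x,y)\in J^2$, $H(y,-G_y(x,y))-H(x,G_x(x,y))\le\gamma$. (v) (Superlinearity) There exists a nondecreasing function $g:[0,+\infty)\to\mathbb{R}$ such that $g(d(x,y))\le G(x,y)$ for all $(x,y)\in J^2$ and $\lim_{a\to+\infty}g(a)/a=+\infty$. (vi) (Gradient bounds) For all $K>0$ there exists $C_K>0$ such that for all $(x,y)\in J^2$, $d(x,y)\le K$ implies $|G_x(x,y)|+|G_y(x,y)|\le C_K$.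
   Context: Junction: $N\ge 1$; $J=\bigcup_{i=1}^N J_i$, where each branch $J_i$ is isometric to $[0,+\infty)$ and $J_i\cap J_j=\{0\}$ for $i\ne j$; $J_i^*=J_i\setminus\{0\}$. $d(x,y)=|x-y|$ if $x,y$ are on the same branch and $|x|+|y|$ otherwise. $C^1(J)$ is the set of continuous functions on $J$ whose restriction to each $J_i$ is $C^1$ (up to $0$). For $u\in C^1(J)$, $\partial_iu(x)$ is the derivative at $x\in J_i$; $u_x(x)=\partial_iu(x)$ if $x\in J_i^*$ and $u_x(0)=(\partial_1u(0),\dots,\partial_Nu(0))\in\mathbb{R}^N$; $|u_x|$ is $|\partial_iu|$ on $J_i^*$ and $\max_i|\partial_iu(0)|$ at $0$. $G_x(x,y)$ and $G_y(x,y)$ denote the gradients in this sense of $G(\cdot,y)$ at $x$ and of $G(x,\cdot)$ at $y$. Quasi-convex: sub-level sets are convex; coercive: $H_i(p)\to+\infty$ as $|p|\to+\infty$. $H_i^-(q)=H_i(q)$ for $q\le0$ and $H_i^-(q)=H_i(0)$ for $q>0$. $F_A(p)=\max\big(A,\max_iH_i^-(p_i)\big)$ for $p=(p_1,\dots,p_N)$. Finally $H(x,p)=H_i(p)$ for $p\in\mathbb{R}$ if $x\in J_i^*$, and $H(0,p)=F_A(p)$ for $p\in\mathbb{R}^N$. *)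

theory Defs
  imports "HOL-Analysis.Analysis"
begin

text \<open>A single ambient type serves all junctions: it has one half-line for every natural number,
  glued at the junction point, and \<open>junction N\<close> consists of the branches \<open>1, \<dots>, N\<close>.
  A point is stored as (branch index, distance to the junction point); the junction point itself
  belongs to every branch and is stored with the dummy index \<open>0\<close>.\<close>

typedef jpoint = "{(i :: nat, t :: real). 0 \<le> t \<and> (t = 0 \<longrightarrow> i = 0)}"
  by (rule exI[of _ "(0, 0)"]) simp

definition index :: "jpoint \<Rightarrow> nat" where
  "index x = fst (Rep_jpoint x)"

definition radius :: "jpoint \<Rightarrow> real" where
  "radius x = snd (Rep_jpoint x)"

definition pt :: "nat \<Rightarrow> real \<Rightarrow> jpoint" where
  "pt i t = Abs_jpoint (if t = 0 then (0, 0) else (i, t))"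

instantiation jpoint :: zero
begin
definition zero_jpoint :: jpoint where
  "0 = Abs_jpoint (0, 0)"
instance ..
end

lemma radius_nonneg [simp]: "0 \<le> radius x"
  using Rep_jpoint[of x] by (auto simp: radius_def)

lemma index_eq_0_if_radius: "radius x = 0 \<Longrightarrow> index x = 0"
  using Rep_jpoint[of x] by (auto simp: radius_def index_def)

lemma jpoint_eqI: "index x = index y \<Longrightarrow> radius x = radius y \<Longrightarrow> x = y"
  by (simp add: index_def radius_def Rep_jpoint_inject[symmetric] prod_eq_iff)

lemma radius_0 [simp]: "radius 0 = 0" and index_0 [simp]: "index 0 = 0"
  by (simp_all add: radius_def index_def zero_jpoint_def Abs_jpoint_inverse)

lemma radius_eq_0_iff [simp]: "radius x = 0 \<longleftrightarrow> x = 0"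
  using index_eq_0_if_radius[of x] by (auto intro: jpoint_eqI)

lemma radius_pt [simp]: "0 \<le> t \<Longrightarrow> radius (pt i t) = t"
  by (simp add: radius_def pt_def Abs_jpoint_inverse)

lemma index_pt: "0 \<le> t \<Longrightarrow> index (pt i t) = (if t = 0 then 0 else i)"
  by (simp add: index_def pt_def Abs_jpoint_inverse)

lemma pt_0 [simp]: "pt i 0 = 0"
  by (simp add: pt_def zero_jpoint_def)

lemma pt_index_radius [simp]: "pt (index x) (radius x) = x"
  by (intro jpoint_eqI) (auto simp: index_pt)

instantiation jpoint :: metric_space
begin

definition dist_jpoint :: "jpoint \<Rightarrow> jpoint \<Rightarrow> real" where
  "dist x y = (if index x = index y then \<bar>radius x - radius y\<bar> else radius x + radius y)"

definition uniformity_jpoint :: "(jpoint \<times> jpoint) filter" where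
  "(uniformity :: (jpoint \<times> jpoint) filter) = (INF e\<in>{0<..}. principal {(x :: jpoint, y). dist x y < e})"

definition open_jpoint :: "jpoint set \<Rightarrow> bool" where
  "open (U :: jpoint set) \<longleftrightarrow> (\<forall>x\<in>U. \<forall>\<^sub>F (x', y) in uniformity. x' = x \<longrightarrow> y \<in> U)"

instance
proof
  fix x y z :: jpoint
  show "dist x y = 0 \<longleftrightarrow> x = y"
    using radius_nonneg[of x] radius_nonneg[of y]
    by (auto simp: dist_jpoint_def intro: jpoint_eqI
        simp del: radius_nonneg split: if_splits) (metis add_nonneg_eq_0_iff radius_eq_0_iff)
  show "dist x y \<le> dist x z + dist y z"
    using radius_nonneg[of x] radius_nonneg[of y] radius_nonneg[of z]
    by (auto simp: dist_jpoint_def abs_if simp del: radius_nonneg)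
qed (simp_all only: uniformity_jpoint_def open_jpoint_def)

end

definition branch :: "nat \<Rightarrow> jpoint set" where
  "branch i = pt i ` {0..}"

definition junction :: "nat \<Rightarrow> jpoint set" where
  "junction N = (\<Union>i\<in>{1..N}. branch i)"

text \<open>These four facts identify \<open>junction N\<close> with the junction of \<open>N\<close> half-lines
  and \<open>dist\<close> with its distance \<open>d\<close>.\<close>

lemma dist_pt_same: "0 \<le> s \<Longrightarrow> 0 \<le> t \<Longrightarrow> dist (pt i s) (pt i t) = \<bar>s - t\<bar>"
  by (auto simp: dist_jpoint_def index_pt)

lemma dist_pt_diff:
  "i \<noteq> j \<Longrightarrow> 0 \<le> s \<Longrightarrow> 0 \<le> t \<Longrightarrow> dist (pt i s) (pt j t) = s + t"
  by (auto simp: dist_jpoint_def index_pt)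

lemma branch_Int:
  assumes "i \<noteq> j"
  shows "branch i \<inter> branch j = {0}"
proof
  show "branch i \<inter> branch j \<subseteq> {0}"
  proof
    fix x assume x: "x \<in> branch i \<inter> branch j"
    then obtain s where s: "x = pt i s" "0 \<le> s" unfolding branch_def by blast
    from x obtain t where t: "x = pt j t" "0 \<le> t" unfolding branch_def by blast
    have "s + t = 0" using dist_pt_diff[OF assms s(2) t(2)] s(1) t(1) by simp
    then have "s = 0" using s(2) t(2) by linarith
    then show "x \<in> {0}" using s(1) by simp
  qed
  have "0 \<in> branch k" for k
    unfolding branch_def by (rule image_eqI[of _ _ 0]) simp_all
  then show "{0} \<subseteq> branch i \<inter> branch j" by simp
qed

lemma in_branch_index: "x \<in> branch i \<Longrightarrow> x \<noteq> 0 \<Longrightarrow> index x = i"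
  by (auto simp: branch_def index_pt split: if_splits)

text \<open>\<open>pderiv_branch i u x\<close> is \<open>\<partial>\<^sub>iu(x)\<close>; it is meaningful for \<open>x \<in> branch i\<close>
  and one-sided at the junction point.\<close>

definition pderiv_branch :: "nat \<Rightarrow> (jpoint \<Rightarrow> real) \<Rightarrow> jpoint \<Rightarrow> real" where
  "pderiv_branch i u x = vector_derivative (\<lambda>t. u (pt i t)) (at (radius x) within {0..})"

definition C1_junction :: "nat \<Rightarrow> (jpoint \<Rightarrow> real) \<Rightarrow> bool" where
  "C1_junction N u \<longleftrightarrow> continuous_on (junction N) u \<and>
     (\<forall>i\<in>{1..N}. (\<lambda>t. u (pt i t)) differentiable_on {0..} \<and>
                  continuous_on (branch i) (pderiv_branch i u))"

text \<open>Gradients are stored as families indexed by the branches. At the junction point all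
  components count; at any other point only the component of the branch containing it does,
  and it stands for the scalar \<open>u\<^sub>x(x)\<close>.\<close>

definition grad :: "(jpoint \<Rightarrow> real) \<Rightarrow> jpoint \<Rightarrow> nat \<Rightarrow> real" where
  "grad u x = (\<lambda>i. if x \<in> branch i then pderiv_branch i u x else 0)"

definition grad_abs :: "nat \<Rightarrow> (jpoint \<Rightarrow> real) \<Rightarrow> jpoint \<Rightarrow> real" where
  "grad_abs N u x =
     (if x = 0 then Max ((\<lambda>i. \<bar>grad u 0 i\<bar>) ` {1..N}) else \<bar>grad u x (index x)\<bar>)"

definition quasiconvex :: "(real \<Rightarrow> real) \<Rightarrow> bool" where
  "quasiconvex h \<longleftrightarrow> (\<forall>c. convex {p. h p \<le> c})"

definition coercive :: "(real \<Rightarrow> real) \<Rightarrow> bool" where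
  "coercive h \<longleftrightarrow> filterlim h at_top at_infinity"

definition dec_part :: "(real \<Rightarrow> real) \<Rightarrow> real \<Rightarrow> real" where
  "dec_part h q = (if q \<le> 0 then h q else h 0)"

text \<open>The flux limiter \<open>A\<close> may be \<open>-\<infinity>\<close>. For \<open>A \<noteq> \<infinity>\<close> and \<open>N \<ge> 1\<close> the maximum is finite,
  so the conversion back to the reals is harmless.\<close>

definition FA :: "nat \<Rightarrow> ereal \<Rightarrow> (nat \<Rightarrow> real \<Rightarrow> real) \<Rightarrow> (nat \<Rightarrow> real) \<Rightarrow> real" where
  "FA N A H p = real_of_ereal (max A (ereal (Max ((\<lambda>i. dec_part (H i) (p i)) ` {1..N}))))"

definition hamiltonian ::
  "nat \<Rightarrow> ereal \<Rightarrow> (nat \<Rightarrow> real \<Rightarrow> real) \<Rightarrow> jpoint \<Rightarrow> (nat \<Rightarrow> real) \<Rightarrow> real" where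
  "hamiltonian N A H x p = (if x = 0 then FA N A H p else H (index x) (p (index x)))"

end

theory Submission imports Defs begin

text \<open>The gradient condition bounds \<open>H(y, -G\<^sub>y)\<close> from above by \<open>H(x, G\<^sub>x)\<close>
  and is therefore one-sided: it survives if \<open>G\<close> is much steeper in \<open>x\<close> than in \<open>y\<close>.
  So \<open>G\<close> need not be built, as one would do for a symmetric requirement, by solving
  \<open>H(y, -G\<^sub>y) = H(x, G\<^sub>x)\<close>. An explicit formula suffices. With two convex
  profiles \<open>\<phi>\<close> and \<open>\<psi>\<close>, with \<open>f = \<phi>'\<close> and \<open>w = \<psi>'\<close> nonnegative and
  \<open>\<phi>(0) = \<psi>(0) = 0\<close>, put for \<open>s = |x|\<close> and \<open>t = |y|\<close>

  \<^item> \<open>G(x, y) = \<phi>(s - t) - \<phi>(-t) + \<psi>(t - s)\<close> if \<open>x\<close> and \<open>y\<close> lie on the same branch,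

  \<^item> \<open>G(x, y) = \<phi>(s) + \<psi>(t) + s t\<close> if they lie on different branches.

  The two formulas agree when one of the points is the junction point. The profile \<open>f\<close>
  vanishes on \<open>(-\<infinity>, -\<epsilon>]\<close> and rises, within a layer of width \<open>\<epsilon>\<close>, to a value \<open>f(0)\<close> so
  large that \<open>H\<^sub>i(f(s)) \<ge> A\<close> for \<open>s \<ge> 0\<close>; the profile \<open>w\<close> vanishes on \<open>(-\<infinity>, \<epsilon>]\<close>.
  Hence \<open>G(x, x) = -\<phi>(-s) \<le> \<epsilon> f(0)\<close>, which is at most \<open>\<gamma>\<close> for small \<open>\<epsilon>\<close>.

  Same branch: if \<open>s - t \<le> -\<epsilon>\<close> then \<open>-G\<^sub>y = G\<^sub>x\<close>. Otherwise the \<open>\<psi>\<close> terms vanish and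
  \<open>-G\<^sub>y = f(s - t) - f(-t)\<close> lies between \<open>0\<close> and \<open>G\<^sub>x = f(s - t)\<close>, where \<open>H\<^sub>i\<close> is
  nondecreasing. The correction \<open>-\<phi>(-t)\<close> thus restores \<open>G \<ge> 0\<close> without hurting the
  gradient condition.

  Different branches: the condition reads \<open>H\<^sub>j(-(w(t) + s)) \<le> H\<^sub>i(f(s) + t)\<close>. By coercivity
  there is an increasing \<open>R\<close> such that \<open>H\<^sub>j(-q) \<le> H\<^sub>i(p)\<close> for all \<open>i, j\<close> and \<open>p, q \<ge> 0\<close> with
  \<open>p \<ge> R(q)\<close> (\<open>comparison_function\<close>). The mixed term \<open>s t\<close> is what gives
  \<open>G\<^sub>x\<close> the contribution \<open>t\<close> that pays for \<open>w(t)\<close>, and its effect \<open>s\<close> on \<open>G\<^sub>y\<close> is paid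
  for by \<open>f(s)\<close>; one takes \<open>f\<close> growing at least as fast as \<open>R(2s)\<close> and \<open>w\<close> at most as
  fast as half the inverse of \<open>R\<close> (\<open>vertex_profiles_exist\<close>).

  At the junction point: the gradient of \<open>G(\<cdot>, y)\<close> at \<open>0\<close> has a component along the branch
  of \<open>y\<close>, and that component already makes \<open>F\<^sub>A\<close> as large as needed. For \<open>x \<noteq> 0\<close>, evaluating
  \<open>F\<^sub>A\<close> at the gradient of \<open>-G(x, \<cdot>)\<close> at \<open>0\<close> only produces terms of the two cases above
  and \<open>A\<close>, which is at most \<open>H\<^sub>i(f(s))\<close>; and the gradient of \<open>G(0, \<cdot>)\<close> at \<open>0\<close> is zero, where
  \<open>F\<^sub>A\<close> is minimal (\<open>G_gradient_compatibility\<close>).\<close>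

section \<open>One-variable tools\<close>

lemma continuous_on_Max_image:
  fixes g :: "'i \<Rightarrow> 'a::topological_space \<Rightarrow> 'b::linorder_topology"
  assumes "finite I" "I \<noteq> {}" "\<And>i. i \<in> I \<Longrightarrow> continuous_on S (g i)"
  shows "continuous_on S (\<lambda>x. Max ((\<lambda>i. g i x) ` I))"
  using assms by (induction I rule: finite_ne_induct) (auto intro!: continuous_on_max)

lemma continuous_on_Min_image:
  fixes g :: "'i \<Rightarrow> 'a::topological_space \<Rightarrow> 'b::linorder_topology"
  assumes "finite I" "I \<noteq> {}" "\<And>i. i \<in> I \<Longrightarrow> continuous_on S (g i)"
  shows "continuous_on S (\<lambda>x. Min ((\<lambda>i. g i x) ` I))"
  using assms by (induction I rule: finite_ne_induct) (auto intro!: continuous_on_min)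

lemma strict_mono_continuous_inverse:
  fixes f :: "real \<Rightarrow> real"
  assumes mono: "strict_mono f" and cont: "continuous_on UNIV f"
    and above: "\<And>y. \<exists>x. y \<le> f x" and below: "\<And>y. \<exists>x. f x \<le> y"
  obtains g where "strict_mono g" "continuous_on UNIV g" "\<And>x. g (f x) = x" "\<And>y. f (g y) = y"
proof -
  have surj: "\<exists>x. f x = y" for y
  proof -
    obtain a b where ab: "f a \<le> y" "y \<le> f b" using above below by blast
    then have "a \<le> b" using mono by (metis linorder_not_less order_trans strict_mono_less)
    then show ?thesis using IVT'[of f a y b] ab cont continuous_on_subset by blast
  qed
  then obtain g where fg: "\<And>y. f (g y) = y" by metis
  have gf: "g (f x) = x" for x
    using fg[of "f x"] mono by (simp add: strict_mono_eq)
  have "isCont g y" for y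
  proof -
    have "isCont g (f (g y))"
      by (rule isCont_inverse_function[where d=1])
        (use gf cont in \<open>auto simp: continuous_on_eq_continuous_at\<close>)
    then show ?thesis by (simp add: fg)
  qed
  then have "continuous_on UNIV g" by (simp add: continuous_on_eq_continuous_at)
  moreover have "strict_mono g"
    using mono fg by (metis strict_mono_def strict_mono_less)
  ultimately show thesis using that gf fg by blast
qed

lemma continuous_has_antiderivative:
  fixes f :: "real \<Rightarrow> real"
  assumes "continuous_on UNIV f"
  obtains F where "\<And>x. (F has_real_derivative f x) (at x)" "F 0 = 0"
proof -
  have "\<exists>F. \<forall>x. - \<infinity> < ereal x \<longrightarrow> ereal x < \<infinity> \<longrightarrow> (F has_vector_derivative f x) (at x)"
    using assms by (intro einterval_antiderivative) (auto simp: continuous_on_eq_continuous_at)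
  then obtain F where F: "\<And>x. (F has_real_derivative f x) (at x)"
    by (auto simp: has_real_derivative_iff_has_vector_derivative)
  show thesis
    by (rule that[of "\<lambda>x. F x - F 0"]) (auto intro!: derivative_eq_intros F)
qed

text \<open>The value is taken at \<open>a / 2\<close> because \<open>x\<close> and \<open>y\<close> on different branches
  have distance \<open>|x| + |y|\<close>, and only the larger of the two radii, which is at least half of it,
  is sure to contribute to \<open>G\<close>.\<close>

lemma antiderivative_superlinear:
  fixes F f :: "real \<Rightarrow> real"
  assumes deriv: "\<And>x. (F has_real_derivative f x) (at x)"
    and "F 0 = 0" and "\<And>x. 0 \<le> f x" and "mono f" and "filterlim f at_top at_top"
  shows "\<forall>\<^sub>F a in at_top. B * a \<le> F (a / 2)"
proof -
  have "\<forall>\<^sub>F a in at_top. 4 * max B 0 \<le> f a"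
    using assms(5) by (simp add: filterlim_at_top)
  then obtain b where b: "\<And>a. b \<le> a \<Longrightarrow> 4 * max B 0 \<le> f a"
    by (auto simp: eventually_at_top_linorder)
  have incr: "F x \<le> F y" if "x \<le> y" for x y
    using that deriv assms(3) by (meson DERIV_nonneg_imp_nondecreasing)
  have "B * a \<le> F (a / 2)" if a: "a > 4 * max b 1" for a
  proof -
    have "0 \<le> a" using a by linarith
    \<comment> \<open>On \<open>[a/4, a/2]\<close> the derivative is at least \<open>4 B\<close>, and the interval has length \<open>a/4\<close>.\<close>
    have "a / 4 < a / 2" using a by simp
    then obtain z where z: "a / 4 < z" "F (a / 2) - F (a / 4) = (a / 2 - a / 4) * f z"
      using MVT2[of "a/4" "a/2" F f] deriv by blast
    have "B * a \<le> (a / 2 - a / 4) * (4 * max B 0)" using mult_right_mono[of B "max B 0" a] \<open>0 \<le> a\<close>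
      by (simp add: mult.commute)
    also have "\<dots> \<le> (a / 2 - a / 4) * f z" using b[of z] z a by (intro mult_left_mono) auto
    also have "\<dots> \<le> F (a / 2)" using z(2) incr[of 0 "a/4"] assms(2) \<open>0 \<le> a\<close> by simp
    finally show ?thesis .
  qed
  then show ?thesis
    unfolding eventually_at_top_dense by blast
qed

section \<open>Comparing the Hamiltonians\<close>

text \<open>The function \<open>R\<close> tells how large a positive slope has to be in order to beat, under every
  \<open>H i\<close>, every \<open>H j\<close> at a given negative slope, as well as the level \<open>a\<close>. Both it and its inverse
  \<open>W\<close> are used later, so both must be continuous: the upper envelope of the
  \<open>H j\<close> and the lower envelope of the \<open>H i\<close> are therefore perturbed into increasing
  homeomorphisms of the line, and \<open>R\<close> is the first followed by the inverse of the second.\<close>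

lemma comparison_function:
  fixes H :: "'i \<Rightarrow> real \<Rightarrow> real" and a :: real
  assumes I: "finite I" "I \<noteq> {}"
    and cont: "\<And>i. i \<in> I \<Longrightarrow> continuous_on UNIV (H i)"
    and coer: "\<And>i. i \<in> I \<Longrightarrow> filterlim (H i) at_top at_top"
    and dec: "\<And>i. i \<in> I \<Longrightarrow> antimono_on {..0} (H i)"
    and inc: "\<And>i. i \<in> I \<Longrightarrow> mono_on {0..} (H i)"
  obtains R W where "strict_mono R" "continuous_on UNIV R" "strict_mono W" "continuous_on UNIV W"
    "\<And>q. W (R q) = q" "\<And>p. R (W p) = p"
    "\<And>p q i j. 0 \<le> p \<Longrightarrow> 0 \<le> q \<Longrightarrow> R q \<le> p \<Longrightarrow> i \<in> I \<Longrightarrow> j \<in> I \<Longrightarrow> H j (- q) \<le> H i p"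
    "\<And>p q i. 0 \<le> p \<Longrightarrow> 0 \<le> q \<Longrightarrow> R q \<le> p \<Longrightarrow> i \<in> I \<Longrightarrow> a \<le> H i p"
proof -
  \<comment> \<open>The perturbations have the signs that keep \<open>m\<close> below and \<open>h\<close> above the true envelopes
      on the positive half-line; on the negative half-line they carry the functions to \<open>-\<infinity>\<close>.\<close>
  define m where "m t = Min ((\<lambda>i. H i (max t 0)) ` I) - exp (- t)" for t
  define h where "h q = max a (Max ((\<lambda>j. H j (- max q 0)) ` I)) + q" for q
  have contH: "continuous_on UNIV (\<lambda>t. H i (g t))" if "i \<in> I" "continuous_on UNIV g"
    for i and g :: "real \<Rightarrow> real"
    using continuous_on_compose2[OF cont[OF that(1)] that(2)] by auto
  have m_cont: "continuous_on UNIV m" unfolding m_def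
    by (intro continuous_intros continuous_on_Min_image contH I)
  have h_cont: "continuous_on UNIV h" unfolding h_def
    by (intro continuous_intros continuous_on_max continuous_on_Max_image contH I)
  have m_mono: "m s < m t" if "s < t" for s t
  proof -
    have "Min ((\<lambda>i. H i (max s 0)) ` I) \<le> Min ((\<lambda>i. H i (max t 0)) ` I)"
      using I that inc
      by (auto intro!: Min.boundedI intro: order_trans[OF Min_le] simp: mono_on_def)
    moreover have "exp (- t) < exp (- s)" using that by simp
    ultimately show ?thesis unfolding m_def by linarith
  qed
  have h_mono: "h s < h t" if "s < t" for s t
  proof -
    have "H j (- max s 0) \<le> Max ((\<lambda>j. H j (- max t 0)) ` I)" if j: "j \<in> I" for j
    proof -
      have "H j (- max s 0) \<le> H j (- max t 0)"
        using dec[OF j] \<open>s < t\<close> by (auto intro: monotone_onD)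
      also have "\<dots> \<le> Max ((\<lambda>j. H j (- max t 0)) ` I)" using I j by auto
      finally show ?thesis .
    qed
    then have "Max ((\<lambda>j. H j (- max s 0)) ` I) \<le> Max ((\<lambda>j. H j (- max t 0)) ` I)"
      using I by auto
    then show ?thesis using that unfolding h_def by linarith
  qed
  have m_above: "\<exists>x. y \<le> m x" for y
  proof -
    have "\<forall>\<^sub>F t in at_top. \<forall>i\<in>I. y + 1 \<le> H i t"
      using coer I by (intro eventually_ball_finite) (auto simp: filterlim_at_top)
    then have "\<forall>\<^sub>F t in at_top. 0 \<le> t \<and> (\<forall>i\<in>I. y + 1 \<le> H i t)"
      using eventually_ge_at_top[of "0::real"] by eventually_elim simp
    then obtain t where t: "0 \<le> t" "\<And>i. i \<in> I \<Longrightarrow> y + 1 \<le> H i t"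
      using eventually_happens'[OF trivial_limit_at_top_linorder, of "\<lambda>t. 0 \<le> t \<and> (\<forall>i\<in>I. y + 1 \<le> H i t)"]
      by blast
    then have "y + 1 \<le> Min ((\<lambda>i. H i (max t 0)) ` I)" using I by (auto simp: max_def)
    moreover have "exp (- t) \<le> 1" using t(1) by simp
    ultimately show ?thesis unfolding m_def by (intro exI[of _ t]) linarith
  qed
  have m_below: "\<exists>x. m x \<le> y" for y
  proof -
    define c where "c = Min ((\<lambda>i. H i 0) ` I)"
    have "m (- \<bar>c - y\<bar>) = c - exp \<bar>c - y\<bar>" by (simp add: m_def c_def)
    also have "\<dots> \<le> y" using exp_ge_add_one_self[of "\<bar>c - y\<bar>"] by linarith
    finally have "m (- \<bar>c - y\<bar>) \<le> y" .
    then show ?thesis by blast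
  qed
  have h_above: "\<exists>x. y \<le> h x" for y
    by (rule exI[of _ "max 0 (y - a)"]) (auto simp: h_def)
  have h_below: "\<exists>x. h x \<le> y" for y
  proof -
    define c where "c = max a (Max ((\<lambda>j. H j 0) ` I))"
    have "h (- \<bar>c - y\<bar>) = c - \<bar>c - y\<bar>" by (simp add: h_def c_def)
    then have "h (- \<bar>c - y\<bar>) \<le> y" by linarith
    then show ?thesis by blast
  qed
  obtain m' where m': "strict_mono m'" "continuous_on UNIV m'" "\<And>x. m' (m x) = x" "\<And>y. m (m' y) = y"
    using strict_mono_continuous_inverse[of m] m_mono m_cont m_above m_below
    by (metis strict_mono_def)
  obtain h' where h': "strict_mono h'" "continuous_on UNIV h'" "\<And>x. h' (h x) = x" "\<And>y. h (h' y) = y"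
    using strict_mono_continuous_inverse[of h] h_mono h_cont h_above h_below
    by (metis strict_mono_def)
  have key: "max a (H j (- q)) \<le> H i p"
    if "0 \<le> p" "0 \<le> q" "m' (h q) \<le> p" "i \<in> I" "j \<in> I" for p q i j
  proof -
    have "H j (- q) \<le> Max ((\<lambda>j. H j (- max q 0)) ` I)" using I that by (auto simp: max_def)
    then have "max a (H j (- q)) \<le> h q" using that unfolding h_def by linarith
    also have "\<dots> \<le> m p" using that(3) m'(4)[of "h q"] m_mono[of "m' (h q)" p] by force
    also have "\<dots> \<le> Min ((\<lambda>i. H i (max p 0)) ` I)" by (simp add: m_def)
    also have "\<dots> \<le> H i p" using I that by (auto simp: max_def intro!: Min_le)
    finally show ?thesis .
  qed
  show thesis
  proof (rule that[of "\<lambda>q. m' (h q)" "\<lambda>p. h' (m p)"])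
    show "strict_mono (\<lambda>q. m' (h q))" "strict_mono (\<lambda>p. h' (m p))"
      using m'(1) h'(1) m_mono h_mono by (simp_all add: strict_mono_def)
    show "continuous_on UNIV (\<lambda>q. m' (h q))" "continuous_on UNIV (\<lambda>p. h' (m p))"
      using continuous_on_compose2[OF m'(2) h_cont] continuous_on_compose2[OF h'(2) m_cont] by auto
  qed (use m' h' key in auto)
qed

section \<open>Functions on the junction\<close>

lemma junction_cases:
  assumes "x \<in> junction N"
  obtains i s where "i \<in> {1..N}" "0 \<le> s" "x = pt i s"
  using assms by (auto simp: junction_def branch_def)

lemma pt_in_branch: "0 \<le> s \<Longrightarrow> pt i s \<in> branch i"
  by (auto simp: branch_def)

lemma pt_eq_0_iff: "0 \<le> s \<Longrightarrow> pt i s = 0 \<longleftrightarrow> s = 0"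
  by (metis pt_0 radius_0 radius_pt)

lemma continuous_on_radius: "continuous_on S radius"
proof -
  have "continuous_on S (\<lambda>x. dist x (0 :: jpoint))" by (intro continuous_intros)
  moreover have "(\<lambda>x. dist x 0) = radius" by (auto simp: dist_jpoint_def)
  ultimately show ?thesis by (simp only:)
qed

text \<open>Along a branch, the functions of interest are restrictions of functions that are
  differentiable on the whole line; the one-sided derivative at the junction point is then
  the ordinary derivative of the extension.\<close>

lemma C1_on_branch:
  assumes u: "\<And>t. 0 \<le> t \<Longrightarrow> u (pt i t) = F t"
    and F: "\<And>t. 0 \<le> t \<Longrightarrow> (F has_real_derivative D t) (at t)"
  shows pderiv_branch_eq: "\<And>t. 0 \<le> t \<Longrightarrow> pderiv_branch i u (pt i t) = D t"
    and "(\<lambda>t. u (pt i t)) differentiable_on {0..}"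
    and "continuous_on {0..} D \<Longrightarrow> continuous_on (branch i) (pderiv_branch i u)"
proof -
  have deriv: "((\<lambda>t. u (pt i t)) has_real_derivative D t) (at t within {0..})" if "0 \<le> t" for t
    using that has_field_derivative_at_within[OF F[OF that]] u
    by (subst has_field_derivative_cong_eventually[where g=F])
      (auto simp: eventually_at_filter)
  then show diff: "(\<lambda>t. u (pt i t)) differentiable_on {0..}"
    by (auto simp: differentiable_on_def real_differentiable_def intro!: exI)
  show pd: "pderiv_branch i u (pt i t) = D t" if "0 \<le> t" for t
  proof -
    have "at t within {0..} \<noteq> bot"
      using that islimpt_subset[of t "{t..t + 1}" "{0..}"] by (auto simp: trivial_limit_within)
    then show ?thesis
      using deriv[OF that] that unfolding pderiv_branch_def
      by (auto intro!: vector_derivative_within simp: has_real_derivative_iff_has_vector_derivative)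
  qed
  show "continuous_on (branch i) (pderiv_branch i u)" if "continuous_on {0..} D"
  proof (rule continuous_on_eq)
    show "continuous_on (branch i) (\<lambda>x. D (radius x))"
      by (rule continuous_on_compose2[OF that continuous_on_radius]) auto
    show "D (radius x) = pderiv_branch i u x" if "x \<in> branch i" for x
      using that pd by (auto simp: branch_def)
  qed
qed

section \<open>The flux limiter\<close>

lemma ereal_FA:
  assumes "1 \<le> N" "A \<noteq> \<infinity>"
  shows "ereal (FA N A H p) = max A (ereal (Max ((\<lambda>i. dec_part (H i) (p i)) ` {1..N})))"
  unfolding FA_def using assms by (intro ereal_real') (auto simp: max_def)

text \<open>Replaces the conversion from extended reals in \<open>FA\<close> by the usual description of a maximum.\<close>

lemma FA_le_iff:
  assumes "1 \<le> N" "A \<noteq> \<infinity>"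
  shows "FA N A H p \<le> c \<longleftrightarrow> A \<le> ereal c \<and> (\<forall>i\<in>{1..N}. dec_part (H i) (p i) \<le> c)"
proof -
  have "FA N A H p \<le> c \<longleftrightarrow> ereal (FA N A H p) \<le> ereal c" by simp
  also have "\<dots> \<longleftrightarrow> A \<le> ereal c \<and> (\<forall>i\<in>{1..N}. dec_part (H i) (p i) \<le> c)"
    using assms by (simp add: ereal_FA)
  finally show ?thesis .
qed

lemma dec_part_le_FA:
  assumes "1 \<le> N" "A \<noteq> \<infinity>" "i \<in> {1..N}"
  shows "dec_part (H i) (p i) \<le> FA N A H p"
  using FA_le_iff[OF assms(1,2), of H p "FA N A H p"] assms(3) by auto

lemma dec_part_ge:
  assumes "antimono_on {..0} h"
  shows "h 0 \<le> dec_part h q"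
  using assms by (auto simp: dec_part_def intro: monotone_onD)

section \<open>The vertex test function\<close>

text \<open>The vanishing conditions on \<open>f\<close> and \<open>w\<close> overlap in such a way that for every \<open>z\<close> at least one
  of \<open>f z\<close> and \<open>w (- z)\<close> is zero: on one branch, \<open>\<phi>\<close> and \<open>\<psi>\<close> never contribute a slope at the same time.\<close>

locale vertex_profiles =
  fixes f w \<phi> \<psi> :: "real \<Rightarrow> real" and \<epsilon> :: real
  assumes eps: "0 < \<epsilon>"
    and f_cont: "continuous_on UNIV f" and w_cont: "continuous_on UNIV w"
    and f_mono: "mono f" and w_mono: "mono w"
    and f_zero: "\<And>z. z \<le> - \<epsilon> \<Longrightarrow> f z = 0" and w_zero: "\<And>z. z \<le> \<epsilon> \<Longrightarrow> w z = 0"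
    and phi_deriv: "\<And>z. (\<phi> has_real_derivative f z) (at z)"
    and psi_deriv: "\<And>z. (\<psi> has_real_derivative w z) (at z)"
    and phi_0 [simp]: "\<phi> 0 = 0" and psi_0 [simp]: "\<psi> 0 = 0"
begin

lemma f_nonneg [simp]: "0 \<le> f z"
  using f_zero[of "min z (- \<epsilon>)"] monoD[OF f_mono, of "min z (- \<epsilon>)" z] by simp

lemma w_nonneg [simp]: "0 \<le> w z"
  using w_zero[of "min z \<epsilon>"] monoD[OF w_mono, of "min z \<epsilon>" z] by simp

lemma phi_mono: "x \<le> y \<Longrightarrow> \<phi> x \<le> \<phi> y"
  using phi_deriv f_nonneg by (meson DERIV_nonneg_imp_nondecreasing)

lemma psi_mono: "x \<le> y \<Longrightarrow> \<psi> x \<le> \<psi> y"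
  using psi_deriv w_nonneg by (meson DERIV_nonneg_imp_nondecreasing)

lemma psi_eq_0:
  assumes "z \<le> \<epsilon>"
  shows "\<psi> z = 0"
proof -
  have const: "\<psi> b = \<psi> a" if "a < b" "b \<le> \<epsilon>" for a b
  proof -
    obtain y where "y < b" "\<psi> b - \<psi> a = (b - a) * w y"
      using MVT2[OF \<open>a < b\<close>, of \<psi> w] psi_deriv by blast
    then show ?thesis using that w_zero[of y] by simp
  qed
  show ?thesis
    using const[of 0 z] const[of z 0] assms eps by (cases z "0 :: real" rule: linorder_cases) auto
qed

lemma psi_nonneg: "0 \<le> \<psi> z"
  using psi_mono[of 0 z] psi_eq_0[of z] eps by (cases "0 \<le> z") auto

text \<open>All of the decrease of \<open>\<phi>\<close> to the left of \<open>0\<close> happens in the layer \<open>[-\<epsilon>, 0]\<close>, where its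
  slope is at most \<open>f 0\<close>.\<close>

lemma phi_lower_bound: "- \<phi> z \<le> \<epsilon> * f 0"
proof (cases "0 \<le> z")
  case True
  then show ?thesis using phi_mono[of 0 z] eps by (smt (verit) f_nonneg phi_0 mult_nonneg_nonneg)
next
  case False
  have bound: "\<phi> 0 - \<phi> (- \<epsilon>) \<le> \<epsilon> * f 0"
  proof -
    obtain y where "- \<epsilon> < y" "y < 0" "\<phi> 0 - \<phi> (- \<epsilon>) = (0 - - \<epsilon>) * f y"
      using MVT2[of "- \<epsilon>" 0 \<phi> f] phi_deriv eps by auto
    then show ?thesis using eps monoD[OF f_mono, of y 0] by simp
  qed
  have "\<phi> (- \<epsilon>) \<le> \<phi> z"
  proof (cases "- \<epsilon> \<le> z")
    case True
    then show ?thesis by (rule phi_mono)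
  next
    case False
    then have "z < - \<epsilon>" by simp
    then obtain y where "y < - \<epsilon>" "\<phi> (- \<epsilon>) - \<phi> z = (- \<epsilon> - z) * f y"
      using MVT2[of z "- \<epsilon>" \<phi> f] phi_deriv by auto
    then show ?thesis by (simp add: f_zero)
  qed
  then show ?thesis using bound by simp
qed

text \<open>The paths from \<open>0\<close> to \<open>x\<close> and to \<open>y\<close> separate at distance
  \<open>(|x| + |y| - dist x y) / 2\<close> from \<open>0\<close>, and \<open>u\<close>, \<open>v\<close> are the distances from that point to \<open>x\<close>
  and \<open>y\<close>. On a common branch one of them is \<open>0\<close>; on different branches they are \<open>|x|\<close> and
  \<open>|y|\<close>. Writing \<open>G\<close> in terms of them merges the formulas of the two cases into one that is
  visibly continuous in the pair.\<close>

definition G :: "jpoint \<Rightarrow> jpoint \<Rightarrow> real" where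
  "G x y = (let u = (dist x y + radius x - radius y) / 2; v = (dist x y - radius x + radius y) / 2
            in \<phi> u + \<psi> v + u * v + \<phi> (- v) - \<phi> (- radius y))"

lemma G_same:
  assumes "0 \<le> s" "0 \<le> t"
  shows "G (pt i s) (pt i t) = \<phi> (s - t) - \<phi> (- t) + \<psi> (t - s)"
  using assms eps psi_eq_0[of "t - s"]
  by (cases "s \<le> t") (simp_all add: G_def dist_pt_same Let_def diff_divide_distrib)

lemma G_diff:
  assumes "i \<noteq> j" "0 \<le> s" "0 \<le> t"
  shows "G (pt i s) (pt j t) = \<phi> s + \<psi> t + s * t"
  using assms by (simp add: G_def dist_pt_diff Let_def)

lemma continuous_on_G:
  assumes "continuous_on S a" "continuous_on S b"
  shows "continuous_on S (\<lambda>z. G (a z) (b z))"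
proof -
  have "continuous_on UNIV \<phi>" "continuous_on UNIV \<psi>"
    by (auto simp: continuous_on_eq_continuous_at intro: DERIV_isCont phi_deriv psi_deriv)
  then have cont_comp: "continuous_on S (\<lambda>z. \<phi> (g z))" "continuous_on S (\<lambda>z. \<psi> (g z))"
    if "continuous_on S g" for g :: "_ \<Rightarrow> real"
    using that by (auto intro: continuous_on_compose2)
  have cont_radius: "continuous_on S (\<lambda>z. radius (a z))" "continuous_on S (\<lambda>z. radius (b z))"
    using assms continuous_on_radius[of UNIV] by (auto intro: continuous_on_compose2)
  show ?thesis
    unfolding G_def Let_def by (intro continuous_intros cont_comp cont_radius assms) simp_all
qed

lemma G_0_0: "G 0 0 = 0"
  using G_same[of 0 0 1] by simp

lemma G_nonneg:
  assumes "x \<in> junction N" "y \<in> junction N"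
  shows "0 \<le> G x y"
proof -
  obtain i s where x: "0 \<le> s" "x = pt i s" using assms(1) by (rule junction_cases)
  obtain j t where y: "0 \<le> t" "y = pt j t" using assms(2) by (rule junction_cases)
  show ?thesis
  proof (cases "i = j")
    case True
    then show ?thesis using x y phi_mono[of "- t" "s - t"] psi_nonneg[of "t - s"] by (simp add: G_same)
  next
    case False
    then show ?thesis using x y phi_mono[of 0 s] psi_nonneg[of t] by (simp add: G_diff)
  qed
qed

lemma G_diagonal: "x \<in> junction N \<Longrightarrow> G x x \<le> \<epsilon> * f 0"
  using phi_lower_bound by (auto elim!: junction_cases simp: G_same)

lemma continuous_on_profile:
  assumes "continuous_on S g"
  shows "continuous_on S (\<lambda>x. f (g x))" "continuous_on S (\<lambda>x. w (g x))"
  using assms f_cont w_cont by (auto intro: continuous_on_compose2)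

lemmas phi_chain = DERIV_chain2[OF phi_deriv]
lemmas psi_chain = DERIV_chain2[OF psi_deriv]

lemma deriv_y_same:
  "((\<lambda>t. \<phi> (s - t) - \<phi> (- t) + \<psi> (t - s)) has_real_derivative - f (s - t) + f (- t) + w (t - s)) (at t)"
  by (auto intro!: derivative_eq_intros phi_chain psi_chain)

lemma deriv_y_diff: "((\<lambda>t. \<phi> s + \<psi> t + s * t) has_real_derivative w t + s) (at t)"
  by (auto intro!: derivative_eq_intros psi_deriv)

lemma deriv_x_same:
  "((\<lambda>s. \<phi> (s - t) - \<phi> (- t) + \<psi> (t - s)) has_real_derivative f (s - t) - w (t - s)) (at s)"
  by (auto intro!: derivative_eq_intros phi_chain psi_chain)

lemma deriv_x_diff: "((\<lambda>s. \<phi> s + \<psi> t + s * t) has_real_derivative f s + t) (at s)"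
  by (auto intro!: derivative_eq_intros phi_deriv)

lemma grad_G_y:
  assumes "0 \<le> s" "0 \<le> t"
  shows "grad (\<lambda>y. G (pt i s) y) (pt j t) j
      = (if i = j then - f (s - t) + f (- t) + w (t - s) else w t + s)"
proof (cases "i = j")
  case True
  then have "G (pt i s) (pt j t) = \<phi> (s - t) - \<phi> (- t) + \<psi> (t - s)" if "0 \<le> t" for t
    using assms that by (simp add: G_same)
  from pderiv_branch_eq[where u="\<lambda>y. G (pt i s) y", OF this deriv_y_same] show ?thesis
    using True assms by (simp add: grad_def pt_in_branch)
next
  case False
  then have "G (pt i s) (pt j t) = \<phi> s + \<psi> t + s * t" if "0 \<le> t" for t
    using assms that by (simp add: G_diff)
  from pderiv_branch_eq[where u="\<lambda>y. G (pt i s) y", OF this deriv_y_diff] show ?thesis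
    using False assms by (simp add: grad_def pt_in_branch)
qed

lemma grad_G_x:
  assumes "0 \<le> s" "0 \<le> t"
  shows "grad (\<lambda>x. G x (pt j t)) (pt i s) i
      = (if i = j then f (s - t) - w (t - s) else f s + t)"
proof (cases "i = j")
  case True
  then have "G (pt i s) (pt j t) = \<phi> (s - t) - \<phi> (- t) + \<psi> (t - s)" if "0 \<le> s" for s
    using assms that by (simp add: G_same)
  from pderiv_branch_eq[where u="\<lambda>x. G x (pt j t)", OF this deriv_x_same] show ?thesis
    using True assms by (simp add: grad_def pt_in_branch)
next
  case False
  then have "G (pt i s) (pt j t) = \<phi> s + \<psi> t + s * t" if "0 \<le> s" for s
    using assms that by (simp add: G_diff)
  from pderiv_branch_eq[where u="\<lambda>x. G x (pt j t)", OF this deriv_x_diff] show ?thesis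
    using False assms by (simp add: grad_def pt_in_branch)
qed

lemma C1_junction_G_y:
  assumes "x \<in> junction N"
  shows "C1_junction N (\<lambda>y. G x y)"
proof -
  obtain i s where x: "0 \<le> s" "x = pt i s" using assms by (rule junction_cases)
  have "(\<lambda>t. G x (pt j t)) differentiable_on {0..} \<and>
        continuous_on (branch j) (pderiv_branch j (\<lambda>y. G x y))" for j
  proof (cases "i = j")
    case True
    then have "G x (pt j t) = \<phi> (s - t) - \<phi> (- t) + \<psi> (t - s)" if "0 \<le> t" for t
      using x that by (simp add: G_same)
    from C1_on_branch(2,3)[where u="\<lambda>y. G x y", OF this deriv_y_same] have
      "(\<lambda>t. G x (pt j t)) differentiable_on {0..}"
      "continuous_on {0..} (\<lambda>t. - f (s - t) + f (- t) + w (t - s)) \<Longrightarrow>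
        continuous_on (branch j) (pderiv_branch j (\<lambda>y. G x y))" by blast+
    moreover have "continuous_on {0..} (\<lambda>t. - f (s - t) + f (- t) + w (t - s))"
      by (intro continuous_intros continuous_on_profile)
    ultimately show ?thesis by blast
  next
    case False
    then have "G x (pt j t) = \<phi> s + \<psi> t + s * t" if "0 \<le> t" for t
      using x that by (simp add: G_diff)
    from C1_on_branch(2,3)[where u="\<lambda>y. G x y", OF this deriv_y_diff] have
      "(\<lambda>t. G x (pt j t)) differentiable_on {0..}"
      "continuous_on {0..} (\<lambda>t. w t + s) \<Longrightarrow>
        continuous_on (branch j) (pderiv_branch j (\<lambda>y. G x y))" by blast+
    moreover have "continuous_on {0..} (\<lambda>t. w t + s)"
      by (intro continuous_intros continuous_on_profile)
    ultimately show ?thesis by blast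
  qed
  then show ?thesis unfolding C1_junction_def by (auto intro!: continuous_on_G continuous_intros)
qed

lemma C1_junction_G_x:
  assumes "y \<in> junction N"
  shows "C1_junction N (\<lambda>x. G x y)"
proof -
  obtain j t where y: "0 \<le> t" "y = pt j t" using assms by (rule junction_cases)
  have "(\<lambda>s. G (pt i s) y) differentiable_on {0..} \<and>
        continuous_on (branch i) (pderiv_branch i (\<lambda>x. G x y))" for i
  proof (cases "i = j")
    case True
    then have "G (pt i s) y = \<phi> (s - t) - \<phi> (- t) + \<psi> (t - s)" if "0 \<le> s" for s
      using y that by (simp add: G_same)
    from C1_on_branch(2,3)[where u="\<lambda>x. G x y", OF this deriv_x_same] have
      "(\<lambda>s. G (pt i s) y) differentiable_on {0..}"
      "continuous_on {0..} (\<lambda>s. f (s - t) - w (t - s)) \<Longrightarrow>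
        continuous_on (branch i) (pderiv_branch i (\<lambda>x. G x y))" by blast+
    moreover have "continuous_on {0..} (\<lambda>s. f (s - t) - w (t - s))"
      by (intro continuous_intros continuous_on_profile)
    ultimately show ?thesis by blast
  next
    case False
    then have "G (pt i s) y = \<phi> s + \<psi> t + s * t" if "0 \<le> s" for s
      using y that by (simp add: G_diff)
    from C1_on_branch(2,3)[where u="\<lambda>x. G x y", OF this deriv_x_diff] have
      "(\<lambda>s. G (pt i s) y) differentiable_on {0..}"
      "continuous_on {0..} (\<lambda>s. f s + t) \<Longrightarrow>
        continuous_on (branch i) (pderiv_branch i (\<lambda>x. G x y))" by blast+
    moreover have "continuous_on {0..} (\<lambda>s. f s + t)"
      by (intro continuous_intros continuous_on_profile)
    ultimately show ?thesis by blast
  qed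
  then show ?thesis unfolding C1_junction_def by (auto intro!: continuous_on_G continuous_intros)
qed

text \<open>One of \<open>\<phi>\<close> and \<open>\<psi>\<close> is always evaluated at half the distance or more, and the other terms of
  \<open>G\<close> only add to it. Which of the two it is depends on the pair, hence the minimum.\<close>

lemma G_superlinear:
  assumes f_lim: "filterlim f at_top at_top" and w_lim: "filterlim w at_top at_top"
  shows "\<exists>g :: real \<Rightarrow> real. mono_on {0..} g \<and>
       (\<forall>x\<in>junction N. \<forall>y\<in>junction N. g (dist x y) \<le> G x y) \<and>
       filterlim (\<lambda>a. g a / a) at_top at_top"
proof (intro exI conjI ballI)
  define g where "g a = min (\<phi> (a / 2)) (\<psi> (a / 2))" for a
  show "mono_on {0..} g"
    by (auto simp: g_def mono_on_def min.coboundedI1 min.coboundedI2 phi_mono psi_mono)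
  show "filterlim (\<lambda>a. g a / a) at_top at_top"
    unfolding filterlim_at_top
  proof
    fix B :: real
    have "\<forall>\<^sub>F a in at_top. B * a \<le> \<phi> (a / 2)"
      by (rule antiderivative_superlinear[OF phi_deriv _ _ f_mono f_lim]) auto
    moreover have "\<forall>\<^sub>F a in at_top. B * a \<le> \<psi> (a / 2)"
      by (rule antiderivative_superlinear[OF psi_deriv _ _ w_mono w_lim]) auto
    ultimately show "\<forall>\<^sub>F a in at_top. B \<le> g a / a"
      using eventually_gt_at_top[of 0] by eventually_elim (simp add: g_def field_simps)
  qed
  fix x y assume "x \<in> junction N" "y \<in> junction N"
  obtain i s where x: "0 \<le> s" "x = pt i s" using \<open>x \<in> junction N\<close> by (rule junction_cases)
  obtain j t where y: "0 \<le> t" "y = pt j t" using \<open>y \<in> junction N\<close> by (rule junction_cases)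
  show "g (dist x y) \<le> G x y"
  proof (cases "i = j")
    case True
    then have G: "G x y = \<phi> (s - t) - \<phi> (- t) + \<psi> (t - s)" and d: "dist x y = \<bar>s - t\<bar>"
      using x y by (simp_all add: G_same dist_pt_same)
    show ?thesis
    proof (cases "t \<le> s")
      case True
      have "g (dist x y) \<le> \<phi> (s - t)" unfolding g_def d
        using True by (intro min.coboundedI1 phi_mono) simp
      then show ?thesis using G phi_mono[of "- t" 0] y psi_nonneg[of "t - s"] by simp
    next
      case False
      have "g (dist x y) \<le> \<psi> (t - s)" unfolding g_def d
        using False by (intro min.coboundedI2 psi_mono) simp
      then show ?thesis using G phi_mono[of "- t" "s - t"] x by simp
    qed
  next
    case False
    then have G: "G x y = \<phi> s + \<psi> t + s * t" and d: "dist x y = s + t"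
      using x y by (simp_all add: G_diff dist_pt_diff)
    have "0 \<le> \<phi> s" "0 \<le> \<psi> t" "0 \<le> s * t" using phi_mono[of 0 s] psi_nonneg x y by simp_all
    moreover have "g (dist x y) \<le> \<phi> s \<or> g (dist x y) \<le> \<psi> t"
    proof (cases "t \<le> s")
      case True
      then show ?thesis unfolding g_def d by (intro disjI1 min.coboundedI1 phi_mono) simp
    next
      case False
      then show ?thesis unfolding g_def d by (intro disjI2 min.coboundedI2 psi_mono) simp
    qed
    ultimately show ?thesis using G by linarith
  qed
qed

lemma grad_abs_le:
  assumes "1 \<le> N" "x \<in> junction N" "\<And>i. i \<in> {1..N} \<Longrightarrow> x \<in> branch i \<Longrightarrow> \<bar>grad u x i\<bar> \<le> B"
  shows "grad_abs N u x \<le> B"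
proof (cases "x = 0")
  case True
  have "0 \<in> branch i" for i using pt_in_branch[of 0 i] by simp
  then show ?thesis using assms True by (auto simp: grad_abs_def)
next
  case False
  moreover obtain i where "i \<in> {1..N}" "x \<in> branch i"
    using assms(2) by (auto simp: junction_def)
  ultimately show ?thesis using assms(3)[of i] by (simp add: grad_abs_def in_branch_index)
qed

text \<open>On one branch the radii are not controlled by the distance; the only term of the gradients
  that does not depend on \<open>s - t\<close> alone is \<open>f (- t)\<close>, which is bounded because \<open>t \<ge> 0\<close>.\<close>

lemma G_gradient_bounds:
  assumes "1 \<le> N" "0 < K"
  shows "\<exists>C>0. \<forall>x\<in>junction N. \<forall>y\<in>junction N. dist x y \<le> K \<longrightarrow>
       grad_abs N (\<lambda>x'. G x' y) x + grad_abs N (\<lambda>y'. G x y') y \<le> C"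
proof (intro exI conjI ballI impI)
  define B where "B = f K + w K + K"
  show "0 < B + B" using assms by (simp add: B_def add_nonneg_pos)
  fix x y assume x: "x \<in> junction N" and y: "y \<in> junction N" and d: "dist x y \<le> K"
  have bounds: "f z \<le> f K" "w z \<le> w K" if "z \<le> K" for z
    using that f_mono w_mono by (auto dest: monoD)
  have nonneg: "0 \<le> f z" "0 \<le> w z" for z by simp_all
  have bound: "\<bar>grad (\<lambda>x'. G x' y) x i\<bar> \<le> B \<and> \<bar>grad (\<lambda>y'. G x y') y j\<bar> \<le> B"
    if xi: "x \<in> branch i" and yj: "y \<in> branch j" for i j
  proof -
    obtain s where s: "0 \<le> s" "x = pt i s" using xi by (auto simp: branch_def)
    obtain t where t: "0 \<le> t" "y = pt j t" using yj by (auto simp: branch_def)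
    note st = s t
    show ?thesis
    proof (cases "i = j")
      case True
      then have "\<bar>s - t\<bar> \<le> K" using d st by (simp add: dist_pt_same)
      then have "f (s - t) \<le> f K" "f (- t) \<le> f K" "w (t - s) \<le> w K"
        using bounds st assms by auto
      moreover have "f (- t) \<le> f (s - t)" using s(1) by (intro monoD[OF f_mono]) simp
      moreover have "grad (\<lambda>x'. G x' y) x i = f (s - t) - w (t - s)"
        "grad (\<lambda>y'. G x y') y j = - f (s - t) + f (- t) + w (t - s)"
        using True st grad_G_x[of s t j i] grad_G_y[of s t i j] by simp_all
      moreover note nonneg[of "s - t"] nonneg[of "t - s"] nonneg[of "- t"] nonneg[of K]
      ultimately show ?thesis
        using assms(2) unfolding B_def by linarith
    next
      case False
      then have "s + t \<le> K" using d st by (simp add: dist_pt_diff)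
      then have "f s \<le> f K" "w t \<le> w K" using bounds st by auto
      moreover have "grad (\<lambda>x'. G x' y) x i = f s + t" "grad (\<lambda>y'. G x y') y j = w t + s"
        using False st grad_G_x[of s t j i] grad_G_y[of s t i j] by simp_all
      moreover note nonneg[of s] nonneg[of t] nonneg[of K]
      ultimately show ?thesis
        using st \<open>s + t \<le> K\<close> unfolding B_def by linarith
    qed
  qed
  obtain i j where "x \<in> branch i" "y \<in> branch j"
    using x y by (auto simp: junction_def)
  then have "grad_abs N (\<lambda>x'. G x' y) x \<le> B" "grad_abs N (\<lambda>y'. G x y') y \<le> B"
    using bound by (auto intro!: grad_abs_le assms(1) x y)
  then show "grad_abs N (\<lambda>x'. G x' y) x + grad_abs N (\<lambda>y'. G x y') y \<le> B + B"
    by simp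
qed

text \<open>The assumption \<open>limiter\<close> is needed when \<open>y\<close> is the junction point and \<open>x\<close> is not, and \<open>cross\<close>
  when \<open>x\<close> and \<open>y\<close> see each other across the junction point. When \<open>x\<close> is the junction point and \<open>y\<close> lies on
  branch \<open>j\<close>, the component \<open>j\<close> of the gradient in \<open>x\<close> suffices, since \<open>F\<^sub>A\<close> is a maximum
  over all components.\<close>

lemma G_gradient_compatibility:
  assumes N: "1 \<le> N" and A: "A \<noteq> \<infinity>"
    and dec: "\<And>i. i \<in> {1..N} \<Longrightarrow> antimono_on {..0} (H i)"
    and inc: "\<And>i. i \<in> {1..N} \<Longrightarrow> mono_on {0..} (H i)"
    and limiter: "\<And>i s. i \<in> {1..N} \<Longrightarrow> 0 \<le> s \<Longrightarrow> A \<le> ereal (H i (f s))"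
    and cross: "\<And>i j s t. i \<in> {1..N} \<Longrightarrow> j \<in> {1..N} \<Longrightarrow> 0 \<le> s \<Longrightarrow> 0 \<le> t \<Longrightarrow>
      H j (- (w t + s)) \<le> H i (f s + t)"
    and x: "x \<in> junction N" and y: "y \<in> junction N"
  shows "hamiltonian N A H y (\<lambda>i. - grad (\<lambda>y'. G x y') y i)
      \<le> hamiltonian N A H x (grad (\<lambda>x'. G x' y) x)"
proof -
  obtain i s where i: "i \<in> {1..N}" and s: "0 \<le> s" "x = pt i s" using x by (rule junction_cases)
  obtain j t where j: "j \<in> {1..N}" and t: "0 \<le> t" "y = pt j t" using y by (rule junction_cases)
  have ham_pos: "hamiltonian N A H (pt k r) p = H k (p k)" if "0 < r" for k r p
    using that by (simp add: hamiltonian_def pt_eq_0_iff index_pt)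
  have ham_0: "hamiltonian N A H 0 p = FA N A H p" for p by (simp add: hamiltonian_def)
  have w_neg: "w r = 0" if "r \<le> 0" for r using that eps by (simp add: w_zero)
  have grad_x_0: "grad (\<lambda>x'. G x' (pt k r)) 0 k = f (- r) - w r" if "0 \<le> r" for k r
    using grad_G_x[of 0 r k k] that by simp
  have grad_y_0: "grad (\<lambda>y'. G (pt i s) y') 0 k = (if i = k then f 0 - f s else s)" for k
    using grad_G_y[of s 0 i k] s w_neg[of "- s"] w_neg[of 0] by simp
  consider "s = 0" "t = 0" | "s = 0" "0 < t" | "0 < s" "t = 0" | "0 < s" "0 < t"
    using s t by linarith
  then show ?thesis
  proof cases
    case 1
    have "dec_part (H k) (- grad (\<lambda>y'. G 0 y') 0 k) \<le> FA N A H p" if "k \<in> {1..N}" for k p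
    proof -
      have "dec_part (H k) (- grad (\<lambda>y'. G 0 y') 0 k) = H k 0"
        using grad_G_y[of 0 0 k k] w_neg[of 0] by (simp add: dec_part_def)
      also have "\<dots> \<le> dec_part (H k) (p k)" by (rule dec_part_ge[OF dec[OF that]])
      also have "\<dots> \<le> FA N A H p" by (rule dec_part_le_FA[OF N A that])
      finally show ?thesis .
    qed
    moreover have "A \<le> ereal (FA N A H p)" for p
      using FA_le_iff[OF N A, of H p "FA N A H p"] by simp
    ultimately show ?thesis using 1 s t by (simp add: ham_0 FA_le_iff[OF N A])
  next
    case 2
    \<comment> \<open>The junction point is regarded as a point of the branch of \<open>y\<close>, so the formulas for
        a common branch apply.\<close>
    have "grad (\<lambda>y'. G 0 y') (pt j t) j = w t"
      using grad_G_y[of 0 t j j] 2 by simp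
    moreover have "H j (- w t) \<le> dec_part (H j) (f (- t) - w t)"
    proof (cases "\<epsilon> \<le> t")
      case True
      then show ?thesis by (simp add: f_zero dec_part_def)
    next
      case False
      then show ?thesis using dec_part_ge[OF dec[OF j]] by (simp add: w_zero)
    qed
    moreover have "dec_part (H j) (f (- t) - w t) \<le> FA N A H (grad (\<lambda>x'. G x' (pt j t)) 0)"
      using dec_part_le_FA[OF N A j, of H "grad (\<lambda>x'. G x' (pt j t)) 0"] t by (simp add: grad_x_0)
    ultimately show ?thesis using 2 s t by (simp add: ham_0 ham_pos)
  next
    case 3
    have "dec_part (H k) (- grad (\<lambda>y'. G (pt i s) y') 0 k) \<le> H i (f s)" if k: "k \<in> {1..N}" for k
    proof (cases "i = k")
      case True
      \<comment> \<open>Along the branch of \<open>x\<close> the slope \<open>f s - f 0\<close> is nonnegative, where \<open>dec_part\<close> is constant.\<close>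
      have "f 0 \<le> f s" using s(1) by (rule monoD[OF f_mono])
      moreover have "grad (\<lambda>y'. G (pt i s) y') 0 k = f 0 - f s" using grad_y_0[of k] True by simp
      ultimately have "dec_part (H k) (- grad (\<lambda>y'. G (pt i s) y') 0 k) = H k 0"
        by (auto simp: dec_part_def)
      also have "\<dots> \<le> H k (f s)" by (rule mono_onD[OF inc[OF k]]) auto
      also have "\<dots> = H i (f s)" using True by simp
      finally show ?thesis .
    next
      case False
      then show ?thesis using cross[OF i k s(1), of 0] s w_neg[of 0] by (simp add: grad_y_0 dec_part_def)
    qed
    moreover have "grad (\<lambda>x'. G x' 0) (pt i s) i = f s"
      using grad_G_x[of s 0 i i] s w_neg[of "- s"] by simp
    ultimately show ?thesis
      using 3 s t limiter[OF i s(1)] by (simp add: ham_0 ham_pos FA_le_iff[OF N A])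
  next
    case 4
    have "H j (- (if i = j then - f (s - t) + f (- t) + w (t - s) else w t + s))
        \<le> H i (if i = j then f (s - t) - w (t - s) else f s + t)"
    proof (cases "i = j")
      case False
      then show ?thesis using cross[OF i j s(1) t(1)] by simp
    next
      case True
      show ?thesis
      proof (cases "s - t \<le> - \<epsilon>")
        case far: True
        then have "f (s - t) = 0" "f (- t) = 0" using s by (auto intro: f_zero)
        then show ?thesis using True by simp
      next
        case False
        then have "w (t - s) = 0" by (intro w_zero) simp
        moreover have "f (- t) \<le> f (s - t)" using s by (intro monoD[OF f_mono]) simp
        moreover have "H i (f (s - t) - f (- t)) \<le> H i (f (s - t))"
          using calculation by (intro mono_onD[OF inc[OF i]]) auto
        ultimately show ?thesis using True by simp
      qed
    qed
    then show ?thesis using 4 s t by (simp add: ham_pos grad_G_x grad_G_y)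
  qed
qed

end

section \<open>Choice of the profiles\<close>

text \<open>The argument \<open>w t + s\<close> is split in two halves. The half that comes from \<open>s\<close> is paid for by \<open>f s\<close>,
  which exceeds \<open>R (2 * s)\<close>; the one from \<open>w t\<close> is paid for by \<open>t\<close>, since \<open>w\<close> is below
  \<open>W / 2\<close>. As \<open>W\<close> may grow arbitrarily slowly and \<open>R\<close> arbitrarily fast, no explicit choice
  such as a polynomial works for all \<open>H\<close>.\<close>

lemma vertex_profiles_exist:
  fixes H :: "'i \<Rightarrow> real \<Rightarrow> real" and a \<gamma> :: real
  assumes "finite I" "I \<noteq> {}" "0 < \<gamma>"
    and "\<And>i. i \<in> I \<Longrightarrow> continuous_on UNIV (H i)"
    and "\<And>i. i \<in> I \<Longrightarrow> filterlim (H i) at_top at_top"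
    and "\<And>i. i \<in> I \<Longrightarrow> antimono_on {..0} (H i)"
    and "\<And>i. i \<in> I \<Longrightarrow> mono_on {0..} (H i)"
  obtains f w \<phi> \<psi> \<epsilon> where "vertex_profiles f w \<phi> \<psi> \<epsilon>" "\<epsilon> * f 0 \<le> \<gamma>"
    "filterlim f at_top at_top" "filterlim w at_top at_top"
    "\<And>i s. i \<in> I \<Longrightarrow> 0 \<le> s \<Longrightarrow> a \<le> H i (f s)"
    "\<And>i j s t. i \<in> I \<Longrightarrow> j \<in> I \<Longrightarrow> 0 \<le> s \<Longrightarrow> 0 \<le> t \<Longrightarrow> H j (- (w t + s)) \<le> H i (f s + t)"
proof (rule comparison_function[where a=a, OF assms(1,2,4-7)])
  fix R W :: "real \<Rightarrow> real"
  assume R: "strict_mono R" "continuous_on UNIV R"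
    and W: "strict_mono W" "continuous_on UNIV W"
    and inv: "\<And>q. W (R q) = q" "\<And>p. R (W p) = p"
    and comp: "\<And>p q i j. 0 \<le> p \<Longrightarrow> 0 \<le> q \<Longrightarrow> R q \<le> p \<Longrightarrow> i \<in> I \<Longrightarrow> j \<in> I \<Longrightarrow>
      H j (- q) \<le> H i p"
    and limiter: "\<And>p q i. 0 \<le> p \<Longrightarrow> 0 \<le> q \<Longrightarrow> R q \<le> p \<Longrightarrow> i \<in> I \<Longrightarrow> a \<le> H i p"
  have R_le: "R p \<le> R q" and W_le: "W p \<le> W q" if "p \<le> q" for p q
    using that R(1) W(1) by (simp_all add: strict_mono_less_eq)
  \<comment> \<open>In \<open>f\<close>, the first factor is a ramp from \<open>0\<close> at \<open>-\<epsilon>\<close> to \<open>1\<close> at \<open>0\<close>. In \<open>w\<close>, the subtracted constant makes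
      the function vanish up to \<open>\<epsilon>\<close>. The width \<open>\<epsilon>\<close> is such that \<open>\<epsilon> * f 0 \<le> \<gamma>\<close>, with
      \<open>f 0 = max 0 (R 0)\<close>.\<close>
  define \<epsilon> where "\<epsilon> = \<gamma> / (1 + max 0 (R 0))"
  define f where "f z = max 0 (min 1 (1 + z / \<epsilon>)) * max 0 (R (2 * z))" for z
  define w where "w y = max 0 (W y / 2 - \<bar>W \<epsilon>\<bar>)" for y
  have eps: "0 < \<epsilon>" using assms(3) by (simp add: \<epsilon>_def add_pos_nonneg)
  have f_pos: "f z = max 0 (R (2 * z))" if "0 \<le> z" for z
    using that eps by (simp add: f_def)
  have f_cont: "continuous_on UNIV f" unfolding f_def
    by (intro continuous_intros continuous_on_max continuous_on_min continuous_on_compose2[OF R(2)])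
      (use eps in auto)
  have w_cont: "continuous_on UNIV w" unfolding w_def
    by (intro continuous_intros continuous_on_max W) simp
  have f_mono: "mono f"
  proof (rule monoI)
    fix x y :: real assume "x \<le> y"
    then have "max 0 (min 1 (1 + x / \<epsilon>)) \<le> max 0 (min 1 (1 + y / \<epsilon>))"
      using divide_right_mono[of x y \<epsilon>] eps by linarith
    moreover have "max 0 (R (2 * x)) \<le> max 0 (R (2 * y))"
      using R_le[of "2 * x" "2 * y"] \<open>x \<le> y\<close> by simp
    ultimately show "f x \<le> f y" unfolding f_def by (intro mult_mono) auto
  qed
  have w_mono: "mono w"
  proof (rule monoI)
    show "w x \<le> w y" if "x \<le> y" for x y
      using W_le[OF that] unfolding w_def by linarith
  qed
  obtain \<phi> where phi: "\<And>z. (\<phi> has_real_derivative f z) (at z)" "\<phi> 0 = 0"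
    using continuous_has_antiderivative[OF f_cont] by blast
  obtain \<psi> where psi: "\<And>z. (\<psi> has_real_derivative w z) (at z)" "\<psi> 0 = 0"
    using continuous_has_antiderivative[OF w_cont] by blast
  have f_zero: "f z = 0" if "z \<le> - \<epsilon>" for z
    using that eps by (simp add: f_def field_simps)
  have w_zero: "w y = 0" if "y \<le> \<epsilon>" for y
    using W_le[OF that] by (simp add: w_def)
  have profiles: "vertex_profiles f w \<phi> \<psi> \<epsilon>"
    by unfold_locales (fact eps f_cont w_cont f_mono w_mono f_zero w_zero phi psi)+
  have small: "\<epsilon> * f 0 \<le> \<gamma>"
  proof -
    have "f 0 \<le> 1 + max 0 (R 0)" by (simp add: f_def)
    then have "\<epsilon> * f 0 \<le> \<epsilon> * (1 + max 0 (R 0))" using eps by (intro mult_left_mono) auto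
    also have "\<dots> = \<gamma>"
      unfolding \<epsilon>_def by (intro nonzero_eq_divide_eq[THEN iffD1]) auto
    finally show ?thesis .
  qed
  have f_lim: "filterlim f at_top at_top"
    unfolding filterlim_at_top eventually_at_top_linorder
  proof (intro allI exI impI)
    fix Z x :: real assume x: "max 0 (W Z) \<le> x"
    then have "R (W Z) \<le> R (2 * x)" by (intro R_le) simp
    then show "Z \<le> f x" using x by (simp add: f_pos inv)
  qed
  have w_lim: "filterlim w at_top at_top"
    unfolding filterlim_at_top eventually_at_top_linorder
  proof (intro allI exI impI)
    fix Z y :: real assume "R (2 * Z + 2 * \<bar>W \<epsilon>\<bar>) \<le> y"
    then have "2 * Z + 2 * \<bar>W \<epsilon>\<bar> \<le> W y" using W_le inv by metis
    then show "Z \<le> w y" unfolding w_def by linarith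
  qed
  have R_f: "R (2 * s) \<le> f s" "0 \<le> f s" if "0 \<le> s" for s
    using that by (simp_all add: f_pos)
  have cross: "R (w t + s) \<le> f s + t" if "0 \<le> s" "0 \<le> t" for s t
  proof -
    have "2 * s \<le> W (f s + t)"
      using W_le[of "R (2 * s)" "f s + t"] R_f[of s] that by (simp add: inv)
    moreover have "W t \<le> W (f s + t)" using R_f[of s] that by (intro W_le) simp
    ultimately have "w t + s \<le> W (f s + t)" using that unfolding w_def by linarith
    then show ?thesis using R_le[of "w t + s" "W (f s + t)"] by (simp add: inv)
  qed
  show thesis
  proof (rule that[OF profiles small f_lim w_lim])
    show "a \<le> H i (f s)" if "i \<in> I" "0 \<le> s" for i s
      using limiter[of "f s" "2 * s" i] R_f that by simp
    show "H j (- (w t + s)) \<le> H i (f s + t)" if "i \<in> I" "j \<in> I" "0 \<le> s" "0 \<le> t" for i j s t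
    proof (rule comp)
      show "0 \<le> w t + s" using that by (simp add: w_def)
    qed (use that R_f cross in auto)
  qed
qed

theorem theorem3p2:
  fixes N :: nat and A :: ereal and \<gamma> :: real and H :: "nat \<Rightarrow> real \<Rightarrow> real"
  assumes "N \<ge> 1" and "A \<noteq> \<infinity>" and "\<gamma> > 0"
    and "\<And>i. i \<in> {1..N} \<Longrightarrow> continuous_on UNIV (H i)"
    and "\<And>i. i \<in> {1..N} \<Longrightarrow> quasiconvex (H i)"
    and "\<And>i. i \<in> {1..N} \<Longrightarrow> coercive (H i)"
    and "\<And>i. i \<in> {1..N} \<Longrightarrow> antimono_on {..0} (H i)"
    and "\<And>i. i \<in> {1..N} \<Longrightarrow> mono_on {0..} (H i)"
    and "H 1 0 = 0"
    and "\<And>i. i \<in> {1..<N} \<Longrightarrow> H i 0 \<ge> H (Suc i) 0"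
  shows "\<exists>G :: jpoint \<Rightarrow> jpoint \<Rightarrow> real.
    (continuous_on (junction N \<times> junction N) (\<lambda>(x, y). G x y) \<and>
     (\<forall>x\<in>junction N. C1_junction N (\<lambda>y. G x y)) \<and>
     (\<forall>y\<in>junction N. C1_junction N (\<lambda>x. G x y))) \<and>
    ((\<forall>x\<in>junction N. \<forall>y\<in>junction N. G x y \<ge> 0) \<and> G 0 0 = 0) \<and>
    (\<forall>x\<in>junction N. 0 \<le> G x x - G 0 0 \<and> G x x - G 0 0 \<le> \<gamma>) \<and>
    (\<forall>x\<in>junction N. \<forall>y\<in>junction N.
       hamiltonian N A H y (\<lambda>i. - grad (\<lambda>y'. G x y') y i)
         - hamiltonian N A H x (grad (\<lambda>x'. G x' y) x) \<le> \<gamma>) \<and>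
    (\<exists>g :: real \<Rightarrow> real. mono_on {0..} g \<and>
       (\<forall>x\<in>junction N. \<forall>y\<in>junction N. g (dist x y) \<le> G x y) \<and>
       filterlim (\<lambda>a. g a / a) at_top at_top) \<and>
    (\<forall>K>0. \<exists>C>0. \<forall>x\<in>junction N. \<forall>y\<in>junction N. dist x y \<le> K \<longrightarrow>
       grad_abs N (\<lambda>x'. G x' y) x + grad_abs N (\<lambda>y'. G x y') y \<le> C)"
proof -
  have coer: "filterlim (H i) at_top at_top" if "i \<in> {1..N}" for i
    using filterlim_mono[OF assms(6)[OF that, unfolded coercive_def] order_refl at_top_le_at_infinity] .
  \<comment> \<open>For \<open>A = -\<infinity>\<close> the level \<open>real_of_ereal A\<close> is \<open>0\<close>, a harmless stricter requirement.\<close>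
  obtain f w \<phi> \<psi> \<epsilon> where prof: "vertex_profiles f w \<phi> \<psi> \<epsilon>" and small: "\<epsilon> * f 0 \<le> \<gamma>"
    and lim: "filterlim f at_top at_top" "filterlim w at_top at_top"
    and limiter: "\<And>i s. i \<in> {1..N} \<Longrightarrow> 0 \<le> s \<Longrightarrow> real_of_ereal A \<le> H i (f s)"
    and cross: "\<And>i j s t. i \<in> {1..N} \<Longrightarrow> j \<in> {1..N} \<Longrightarrow> 0 \<le> s \<Longrightarrow> 0 \<le> t \<Longrightarrow>
      H j (- (w t + s)) \<le> H i (f s + t)"
    by (rule vertex_profiles_exist[of "{1..N}" \<gamma> H "real_of_ereal A"])
      (use assms coer in auto)
  interpret vertex_profiles f w \<phi> \<psi> \<epsilon> by (fact prof)
  have limiter': "A \<le> ereal (H i (f s))" if "i \<in> {1..N}" "0 \<le> s" for i s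
    using limiter[OF that] assms(2) by (cases A) auto
  have compat: "hamiltonian N A H y (\<lambda>i. - grad (\<lambda>y'. G x y') y i)
      \<le> hamiltonian N A H x (grad (\<lambda>x'. G x' y) x)"
    if "x \<in> junction N" "y \<in> junction N" for x y
    by (rule G_gradient_compatibility[OF assms(1,2)])
      (fact assms(7) assms(8) limiter' cross that)+
  show ?thesis
  proof (rule exI[of _ G], intro conjI ballI)
    show "continuous_on (junction N \<times> junction N) (\<lambda>(x, y). G x y)"
      unfolding case_prod_beta by (intro continuous_on_G continuous_intros)
    fix x y assume x: "x \<in> junction N" and y: "y \<in> junction N"
    show "hamiltonian N A H y (\<lambda>i. - grad (\<lambda>y'. G x y') y i)
         - hamiltonian N A H x (grad (\<lambda>x'. G x' y) x) \<le> \<gamma>"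
      using compat[OF x y] assms(3) by linarith
  next
    show "\<forall>K>0. \<exists>C>0. \<forall>x\<in>junction N. \<forall>y\<in>junction N. dist x y \<le> K \<longrightarrow>
       grad_abs N (\<lambda>x'. G x' y) x + grad_abs N (\<lambda>y'. G x y') y \<le> C"
      using G_gradient_bounds[OF assms(1)] by blast
  next
    fix x assume x: "x \<in> junction N"
    show "C1_junction N (\<lambda>y. G x y)" by (rule C1_junction_G_y[OF x])
    show "C1_junction N (\<lambda>x'. G x' x)" by (rule C1_junction_G_x[OF x])
    show "0 \<le> G x x - G 0 0" using G_nonneg[OF x x] G_0_0 by simp
    show "G x x - G 0 0 \<le> \<gamma>" using G_diagonal[OF x] small G_0_0 by simp
    show "0 \<le> G x y" if "y \<in> junction N" for y by (rule G_nonneg[OF x that])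
  next
    show "G 0 0 = 0" by (rule G_0_0)
    show "\<exists>g :: real \<Rightarrow> real. mono_on {0..} g \<and>
       (\<forall>x\<in>junction N. \<forall>y\<in>junction N. g (dist x y) \<le> G x y) \<and>
       filterlim (\<lambda>a. g a / a) at_top at_top"
      by (rule G_superlinear[OF lim])
  qed
qed

end
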